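(* Let $C$ be a commutative ring, $R$ a $C$-algebra, $G$ a semigroup, $\delta : G \to R$ a central map that preserves zero, and $I \subseteq \overline{CG}$ an ideal. If $t_\delta (I) = 0$, then $\bar{t}_\delta (r+I) = t_\delta (r)$ defines a $C$-linear trace $\bar{t}_\delta : \overline{CG}/I \to R$. Moreover, $t_\delta$ is minimal if and only if $\bar{t}_\delta$ is minimal and $I \subseteq [\overline{CG}, \overline{CG}]$.
   Context: Rings are associative but not necessarily unital. "Semigroup" means a semigroup with zero. $\overline{CG}$ is the contracted semigroup ring, i.e., the semigroup ring $CG$ with the zero of $G$ identified with the zero of $CG$; its elements are written $\sum_g a_g g$ with $g$ ranging over the nonzero elements of $G$, $a_g\in C$, and all but finitely many $a_g$ equal to zero. A map $\delta:G\to R$ preserves zero if it takes zero to zero, and is central if $\delta(gh)=\delta(hg)$ for all $g,h\in G$. For a map $\delta: G \to R$ that preserves zero, $t_\delta:\overline{CG}\to R$ denotes the map $t_\delta(\sum_g a_gg)=\sum_g a_g\delta(g)$; when $\delta$ is central, this is a $C$-linear trace. For rings $A$ and $T$, a ($T$-valued) trace on $A$ is a map $t:A\to T$ with $t(x+y)=t(x)+t(y)$ and $t(xy)=t(yx)$ for all $x,y\in A$; when $A$ and $T$ are $C$-algebras, it is $C$-linear if $t(cx)=ct(x)$ for all $c\in C$, $x\in A$; it is minimal if for all $x \in A$, $t(x)=0$ implies $x\in[A,A]$, where $[A,A]$ is the additive subgroup of $A$ generated by all commutators $xy-yx$ ($x,y\in A$). *)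

theory Defs
  imports "HOL-Algebra.QuotRing" "HOL-Algebra.Module" "HOL-Algebra.Generated_Groups"
begin

text \<open>
  Rings here need not have an identity, so the locales \<^locale>\<open>ring\<close>, \<^locale>\<open>ideal\<close> and
  \<^locale>\<open>algebra\<close> do not apply. The record types of HOL-Algebra are reused all the same;
  nothing below depends on the field \<^const>\<open>one\<close>.
\<close>

locale rng = abelian_group R for R (structure) +
  assumes rng_m_closed: "\<lbrakk>x \<in> carrier R; y \<in> carrier R\<rbrakk> \<Longrightarrow> x \<otimes> y \<in> carrier R"
    and rng_m_assoc: "\<lbrakk>x \<in> carrier R; y \<in> carrier R; z \<in> carrier R\<rbrakk>
      \<Longrightarrow> (x \<otimes> y) \<otimes> z = x \<otimes> (y \<otimes> z)"
    and rng_l_distr: "\<lbrakk>x \<in> carrier R; y \<in> carrier R; z \<in> carrier R\<rbrakk>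
      \<Longrightarrow> (x \<oplus> y) \<otimes> z = x \<otimes> z \<oplus> y \<otimes> z"
    and rng_r_distr: "\<lbrakk>x \<in> carrier R; y \<in> carrier R; z \<in> carrier R\<rbrakk>
      \<Longrightarrow> z \<otimes> (x \<oplus> y) = z \<otimes> x \<oplus> z \<otimes> y"

locale comm_rng = rng +
  assumes rng_m_comm: "\<lbrakk>x \<in> carrier R; y \<in> carrier R\<rbrakk> \<Longrightarrow> x \<otimes> y = y \<otimes> x"

text \<open>
  As \<open>C\<close> may lack an identity, no unitality of the action is demanded. Algebras over a ring
  with identity whose identity acts trivially are a special case.
\<close>

locale rng_algebra = C: comm_rng C + A: rng A
  for C :: "('c, 'k) ring_scheme" and A :: "('c, 'a, 'm) module_scheme" +
  assumes alg_smult_closed: "\<lbrakk>c \<in> carrier C; x \<in> carrier A\<rbrakk> \<Longrightarrow> c \<odot>\<^bsub>A\<^esub> x \<in> carrier A"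
    and alg_smult_l_distr: "\<lbrakk>c \<in> carrier C; d \<in> carrier C; x \<in> carrier A\<rbrakk>
      \<Longrightarrow> (c \<oplus>\<^bsub>C\<^esub> d) \<odot>\<^bsub>A\<^esub> x = c \<odot>\<^bsub>A\<^esub> x \<oplus>\<^bsub>A\<^esub> d \<odot>\<^bsub>A\<^esub> x"
    and alg_smult_r_distr: "\<lbrakk>c \<in> carrier C; x \<in> carrier A; y \<in> carrier A\<rbrakk>
      \<Longrightarrow> c \<odot>\<^bsub>A\<^esub> (x \<oplus>\<^bsub>A\<^esub> y) = c \<odot>\<^bsub>A\<^esub> x \<oplus>\<^bsub>A\<^esub> c \<odot>\<^bsub>A\<^esub> y"
    and alg_smult_assoc: "\<lbrakk>c \<in> carrier C; d \<in> carrier C; x \<in> carrier A\<rbrakk>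
      \<Longrightarrow> (c \<otimes>\<^bsub>C\<^esub> d) \<odot>\<^bsub>A\<^esub> x = c \<odot>\<^bsub>A\<^esub> (d \<odot>\<^bsub>A\<^esub> x)"
    and alg_smult_mult_l: "\<lbrakk>c \<in> carrier C; x \<in> carrier A; y \<in> carrier A\<rbrakk>
      \<Longrightarrow> (c \<odot>\<^bsub>A\<^esub> x) \<otimes>\<^bsub>A\<^esub> y = c \<odot>\<^bsub>A\<^esub> (x \<otimes>\<^bsub>A\<^esub> y)"
    and alg_smult_mult_r: "\<lbrakk>c \<in> carrier C; x \<in> carrier A; y \<in> carrier A\<rbrakk>
      \<Longrightarrow> x \<otimes>\<^bsub>A\<^esub> (c \<odot>\<^bsub>A\<^esub> y) = c \<odot>\<^bsub>A\<^esub> (x \<otimes>\<^bsub>A\<^esub> y)"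

locale rng_ideal = additive_subgroup I R + rng R for I and R (structure) +
  assumes ideal_l_closed: "\<lbrakk>a \<in> I; x \<in> carrier R\<rbrakk> \<Longrightarrow> x \<otimes> a \<in> I"
    and ideal_r_closed: "\<lbrakk>a \<in> I; x \<in> carrier R\<rbrakk> \<Longrightarrow> a \<otimes> x \<in> I"

record 'g zsemigroup = "'g partial_object" +
  smul :: "['g, 'g] \<Rightarrow> 'g" (infixl \<open>\<cdot>\<index>\<close> 70)
  szero :: 'g

locale semigroup_with_zero =
  fixes G :: "('g, 'n) zsemigroup_scheme" (structure)
  assumes smul_closed: "\<lbrakk>g \<in> carrier G; h \<in> carrier G\<rbrakk> \<Longrightarrow> g \<cdot> h \<in> carrier G"
    and smul_assoc: "\<lbrakk>g \<in> carrier G; h \<in> carrier G; k \<in> carrier G\<rbrakk>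
      \<Longrightarrow> (g \<cdot> h) \<cdot> k = g \<cdot> (h \<cdot> k)"
    and szero_closed: "szero G \<in> carrier G"
    and szero_l: "g \<in> carrier G \<Longrightarrow> szero G \<cdot> g = szero G"
    and szero_r: "g \<in> carrier G \<Longrightarrow> g \<cdot> szero G = szero G"

text \<open>
  An element \<open>\<Sum>g. a\<^sub>g g\<close> of the contracted semigroup ring is its coefficient function \<open>a\<close>, which
  vanishes off the nonzero elements of \<open>G\<close>; products of basis elements that are zero in \<open>G\<close>
  are dropped by the multiplication.
\<close>

definition supp :: "('c, 'k) ring_scheme \<Rightarrow> ('g \<Rightarrow> 'c) \<Rightarrow> 'g set" where
  "supp C a = {g. a g \<noteq> \<zero>\<^bsub>C\<^esub>}"

definition contracted_ring ::
  "('c, 'k) ring_scheme \<Rightarrow> ('g, 'n) zsemigroup_scheme \<Rightarrow> ('c, 'g \<Rightarrow> 'c) module" where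
  "contracted_ring C G =
    \<lparr>carrier = {a \<in> UNIV \<rightarrow> carrier C. finite (supp C a) \<and> supp C a \<subseteq> carrier G - {szero G}},
     mult = (\<lambda>a b x. if x = szero G then \<zero>\<^bsub>C\<^esub>
       else finsum C (\<lambda>(g, h). a g \<otimes>\<^bsub>C\<^esub> b h)
              {(g, h). g \<in> supp C a \<and> h \<in> supp C b \<and> g \<cdot>\<^bsub>G\<^esub> h = x}),
     one = undefined,
     zero = (\<lambda>x. \<zero>\<^bsub>C\<^esub>),
     add = (\<lambda>a b x. a x \<oplus>\<^bsub>C\<^esub> b x),
     smult = (\<lambda>c a x. c \<otimes>\<^bsub>C\<^esub> a x)\<rparr>"

definition t_map ::
  "('c, 'k) ring_scheme \<Rightarrow> ('c, 'r, 'm) module_scheme \<Rightarrow> ('g \<Rightarrow> 'r) \<Rightarrow> ('g \<Rightarrow> 'c) \<Rightarrow> 'r" where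
  "t_map C R \<delta> a = finsum R (\<lambda>g. a g \<odot>\<^bsub>R\<^esub> \<delta> g) (supp C a)"

text \<open>
  The scalar multiple \<open>c (x + I)\<close> is formed like \<^const>\<open>rcoset_mult\<close>, as the union of the
  cosets \<open>c y + I\<close> with \<open>y \<in> x + I\<close>. If \<open>I\<close> is stable under scalars it is the single coset
  \<open>c x + I\<close>. A ring ideal of an algebra without identity need not be stable.
\<close>

definition quot_alg :: "('c, 'a, 'm) module_scheme \<Rightarrow> 'a set \<Rightarrow> ('c, 'a set) module" where
  "quot_alg A I =
    \<lparr>carrier = carrier (A Quot I), mult = mult (A Quot I), one = one (A Quot I),
     zero = zero (A Quot I), add = add (A Quot I),
     smult = (\<lambda>c X. \<Union>x\<in>X. I +>\<^bsub>A\<^esub> (c \<odot>\<^bsub>A\<^esub> x))\<rparr>"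

text \<open>The common value of \<open>t\<close> on a coset; meaningful only where \<open>t\<close> is constant.\<close>

definition induced :: "('a \<Rightarrow> 'r) \<Rightarrow> 'a set \<Rightarrow> 'r" where
  "induced t X = the_elem (t ` X)"

locale ring_trace = A: rng A + T: rng T
  for A :: "('a, 'k) ring_scheme" and T :: "('r, 'l) ring_scheme" and t :: "'a \<Rightarrow> 'r" +
  assumes trace_closed: "t \<in> carrier A \<rightarrow> carrier T"
    and trace_add: "\<lbrakk>x \<in> carrier A; y \<in> carrier A\<rbrakk> \<Longrightarrow> t (x \<oplus>\<^bsub>A\<^esub> y) = t x \<oplus>\<^bsub>T\<^esub> t y"
    and trace_mult: "\<lbrakk>x \<in> carrier A; y \<in> carrier A\<rbrakk> \<Longrightarrow> t (x \<otimes>\<^bsub>A\<^esub> y) = t (y \<otimes>\<^bsub>A\<^esub> x)"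

locale linear_trace = ring_trace A T t
  for C :: "('c, 'h) ring_scheme" and A :: "('c, 'a, 'k) module_scheme"
    and T :: "('c, 'r, 'l) module_scheme" and t :: "'a \<Rightarrow> 'r" +
  assumes trace_smult: "\<lbrakk>c \<in> carrier C; x \<in> carrier A\<rbrakk> \<Longrightarrow> t (c \<odot>\<^bsub>A\<^esub> x) = c \<odot>\<^bsub>T\<^esub> t x"

definition commutators :: "('a, 'k) ring_scheme \<Rightarrow> 'a set" where
  "commutators A = generate (add_monoid A)
    {x \<otimes>\<^bsub>A\<^esub> y \<ominus>\<^bsub>A\<^esub> y \<otimes>\<^bsub>A\<^esub> x | x y. x \<in> carrier A \<and> y \<in> carrier A}"

definition minimal :: "('a, 'k) ring_scheme \<Rightarrow> ('r, 'l) ring_scheme \<Rightarrow> ('a \<Rightarrow> 'r) \<Rightarrow> bool" where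
  "minimal A T t \<longleftrightarrow> (\<forall>x\<in>carrier A. t x = \<zero>\<^bsub>T\<^esub> \<longrightarrow> x \<in> commutators A)"

end

theory Submission
  imports Defs
begin

section \<open>Rings without identity\<close>

text \<open>By additivity t(h + x) = t(x) for h in I, so t_\<delta> is constant on cosets and the
  trace identities pass to the quotient (\<open>induced_coset\<close>,
  \<open>ring_trace_induced\<close>). That t_\<delta> is itself a trace comes down to one formula
  (\<open>t_map_mult\<close>): t_\<delta>(ab) is the sum of a_g b_h \<delta>(gh) over all pairs from
  the two supports. Exchanging g and h does not change it, since C is commutative and \<delta> is
  central (\<open>t_map_mult_commute\<close>).

  For minimality, write A for the contracted ring. The projection from A to A/I is a surjective
  homomorphism, so [A/I, A/I] is the image of [A, A] (\<open>commutators_quot_alg\<close>). If t is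
  minimal, then I, on which t vanishes, lies in [A, A], and a coset killed by the induced trace has
  its representatives in [A, A]. Conversely, if t(x) = 0, minimality of the induced trace gives s in
  [A, A] with x - s in I, and I inside [A, A] then puts x in [A, A]
  (\<open>minimal_iff_minimal_induced\<close>).

  The ring axioms of A come with the hypothesis \<open>rng_ideal I CG\<close>. The ideal is not
  assumed stable under scalars; the induced trace is linear all the same, because t is constant on
  the union of cosets that stands for c(x + I) (\<open>induced_smult\<close>). The algebra axioms of
  the quotient are proved for stable I.\<close>

lemma (in abelian_group_hom) hom_finsum:
  assumes "f \<in> S \<rightarrow> carrier G"
  shows "h (finsum G f S) = finsum H (\<lambda>i. h (f i)) S"
  using assms
proof (induction S rule: infinite_finite_induct)
  case (insert i S)
  then have "(\<lambda>i. h (f i)) \<in> S \<rightarrow> carrier H" and "f \<in> S \<rightarrow> carrier G" and "f i \<in> carrier G"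
    by (auto simp: Pi_iff)
  with insert show ?case
    by simp
qed simp_all

lemma abelian_group_homI':
  assumes "abelian_group G" and "abelian_group H"
    and "h \<in> carrier G \<rightarrow> carrier H"
    and "\<And>x y. \<lbrakk>x \<in> carrier G; y \<in> carrier G\<rbrakk> \<Longrightarrow> h (x \<oplus>\<^bsub>G\<^esub> y) = h x \<oplus>\<^bsub>H\<^esub> h y"
  shows "abelian_group_hom G H h"
  using assms
  by (intro abelian_group_homI group_hom.intro group_hom_axioms.intro)
     (auto simp: hom_def abelian_group.a_group)

context rng
begin

text \<open>Viewing multiplication by a fixed element as an additive homomorphism yields the null
  laws from \<open>hom_zero\<close> and distributivity over finite sums from
  \<open>hom_finsum\<close>. \<open>hom_smult\<close> and \<open>hom_scalar\<close> do the same for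
  the scalar action.\<close>

lemma hom_l_mult: "x \<in> carrier R \<Longrightarrow> abelian_group_hom R R (\<lambda>y. x \<otimes> y)"
  by (intro abelian_group_homI' abelian_group_axioms) (auto simp: rng_m_closed rng_r_distr)

lemma hom_r_mult: "x \<in> carrier R \<Longrightarrow> abelian_group_hom R R (\<lambda>y. y \<otimes> x)"
  by (intro abelian_group_homI' abelian_group_axioms) (auto simp: rng_m_closed rng_l_distr)

lemma rng_r_null [simp]: "x \<in> carrier R \<Longrightarrow> x \<otimes> \<zero> = \<zero>"
  using abelian_group_hom.hom_zero[OF hom_l_mult] by simp

lemma rng_l_null [simp]: "x \<in> carrier R \<Longrightarrow> \<zero> \<otimes> x = \<zero>"
  using abelian_group_hom.hom_zero[OF hom_r_mult] by simp

lemma commutator_set_subset: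
  "{x \<otimes> y \<ominus> y \<otimes> x | x y. x \<in> carrier R \<and> y \<in> carrier R} \<subseteq> carrier R"
  by (auto simp: rng_m_closed)

lemma subgroup_commutators: "subgroup (commutators R) (add_monoid R)"
  unfolding commutators_def
  using group.generate_is_subgroup[OF a_group] commutator_set_subset by simp

end

context rng_algebra
begin

lemma hom_smult: "c \<in> carrier C \<Longrightarrow> abelian_group_hom A A (\<lambda>x. c \<odot>\<^bsub>A\<^esub> x)"
  by (intro abelian_group_homI' A.abelian_group_axioms)
     (auto simp: alg_smult_closed alg_smult_r_distr)

lemma hom_scalar: "x \<in> carrier A \<Longrightarrow> abelian_group_hom C A (\<lambda>c. c \<odot>\<^bsub>A\<^esub> x)"
  by (intro abelian_group_homI' A.abelian_group_axioms C.abelian_group_axioms)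
     (auto simp: alg_smult_closed alg_smult_l_distr)

lemma smult_zero_r [simp]: "c \<in> carrier C \<Longrightarrow> c \<odot>\<^bsub>A\<^esub> \<zero>\<^bsub>A\<^esub> = \<zero>\<^bsub>A\<^esub>"
  using abelian_group_hom.hom_zero[OF hom_smult] by simp

lemma smult_zero_l [simp]: "x \<in> carrier A \<Longrightarrow> \<zero>\<^bsub>C\<^esub> \<odot>\<^bsub>A\<^esub> x = \<zero>\<^bsub>A\<^esub>"
  using abelian_group_hom.hom_zero[OF hom_scalar] by simp

end

section \<open>Quotients by ideals\<close>

text \<open>Fixes the ambient ring at a module type, so that scalar multiples and
  \<open>quot_alg A I\<close> can be formed. The sublocale below supplies the coset calculus of
  \<open>abelian_subgroup\<close>.\<close>

locale rng_ideal_of_module = rng_ideal I A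
  for I and A :: "('c, 'a, 'm) module_scheme" (structure)

sublocale rng_ideal_of_module \<subseteq> abelian_subgroup I A
  by (intro abelian_subgroupI3 additive_subgroup_axioms abelian_group_axioms)

context rng_ideal_of_module
begin

lemma mem_coset_iff: "y \<in> I +> x \<longleftrightarrow> (\<exists>h\<in>I. y = h \<oplus> x)"
  by (auto simp: a_r_coset_def')

lemma coset_shift: "\<lbrakk>h \<in> I; x \<in> carrier A\<rbrakk> \<Longrightarrow> I +> (h \<oplus> x) = I +> x"
  using a_repr_independence'[of "h \<oplus> x" x] by (auto simp: mem_coset_iff)

text \<open>\<open>rcoset_mult\<close> is a union of cosets, one for each pair of representatives.
  They all coincide, as (h + x)(k + y) = (h(k + y) + xk) + xy with the bracket in I.\<close>

lemma coset_mult: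
  assumes x: "x \<in> carrier A" and y: "y \<in> carrier A"
  shows "rcoset_mult A I (I +> x) (I +> y) = I +> (x \<otimes> y)"
proof -
  have *: "I +> (a \<otimes> b) = I +> (x \<otimes> y)" if "a \<in> I +> x" and "b \<in> I +> y" for a b
  proof -
    obtain h k where hk: "h \<in> I" "k \<in> I" "a = h \<oplus> x" "b = k \<oplus> y"
      using \<open>a \<in> I +> x\<close> \<open>b \<in> I +> y\<close> by (auto simp: mem_coset_iff)
    then have "a \<otimes> b = (h \<otimes> (k \<oplus> y) \<oplus> x \<otimes> k) \<oplus> x \<otimes> y"
      using x y by (simp add: rng_l_distr rng_r_distr rng_m_closed a_ac)
    moreover have "h \<otimes> (k \<oplus> y) \<oplus> x \<otimes> k \<in> I"
      using hk x y by (simp add: ideal_l_closed ideal_r_closed)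
    ultimately show ?thesis
      using x y by (simp add: coset_shift rng_m_closed)
  qed
  then show ?thesis
    using a_rcos_self[OF x] a_rcos_self[OF y] unfolding rcoset_mult_def by blast
qed

lemma quot_alg_simps:
  "carrier (quot_alg A I) = (+>) I ` carrier A"
  "mult (quot_alg A I) = rcoset_mult A I"
  "add (quot_alg A I) = set_add A"
  "zero (quot_alg A I) = I"
  "smult (quot_alg A I) = (\<lambda>c X. \<Union>x\<in>X. I +> (c \<odot> x))"
  by (auto simp: quot_alg_def FactRing_def A_RCOSETS_def')

lemma rng_quot_alg: "rng (quot_alg A I)"
proof -
  have zero: "I = I +> \<zero>"
    by (simp add: a_subset)
  have "abelian_group (quot_alg A I)"
  proof (rule abelian_groupI)
    fix X assume "X \<in> carrier (quot_alg A I)"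
    then obtain x where x: "x \<in> carrier A" "X = I +> x"
      by (auto simp: quot_alg_simps)
    then have "(I +> \<ominus> x) \<oplus>\<^bsub>quot_alg A I\<^esub> X = \<zero>\<^bsub>quot_alg A I\<^esub>"
      by (simp add: quot_alg_simps a_rcos_sum l_neg a_subset)
    moreover have "I +> \<ominus> x \<in> carrier (quot_alg A I)"
      using x by (simp add: quot_alg_simps)
    ultimately show "\<exists>Y\<in>carrier (quot_alg A I). Y \<oplus>\<^bsub>quot_alg A I\<^esub> X = \<zero>\<^bsub>quot_alg A I\<^esub>"
      by blast
    show "\<zero>\<^bsub>quot_alg A I\<^esub> \<oplus>\<^bsub>quot_alg A I\<^esub> X = X"
      using x a_rcos_sum[OF add.one_closed x(1)] by (simp add: quot_alg_simps a_subset)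
  next
    show "\<zero>\<^bsub>quot_alg A I\<^esub> \<in> carrier (quot_alg A I)"
      \<comment> \<open>The zero of the quotient is I itself, which must first be written as a coset
        to lie in the image that forms the carrier.\<close>
      unfolding quot_alg_simps by (subst zero) blast
  qed (auto simp: quot_alg_simps a_rcos_sum a_ac)
  then show ?thesis
    by (intro rng.intro rng_axioms.intro)
       (auto simp: quot_alg_simps coset_mult a_rcos_sum rng_m_closed rng_m_assoc
         rng_l_distr rng_r_distr)
qed

lemma hom_coset: "abelian_group_hom A (quot_alg A I) ((+>) I)"
  by (intro abelian_group_homI' abelian_group_axioms rng.axioms(1) rng_quot_alg)
     (auto simp: quot_alg_simps a_rcos_sum)

text \<open>The projection is onto and multiplicative, so commutators of cosets are exactly the
  images of commutators; generating a subgroup commutes with taking images under a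
  homomorphism.\<close>

lemma commutators_quot_alg: "commutators (quot_alg A I) = (+>) I ` commutators A"
proof -
  interpret q: abelian_group_hom A "quot_alg A I" "(+>) I"
    by (rule hom_coset)
  have minus: "I +> (x \<ominus> y) = (I +> x) \<ominus>\<^bsub>quot_alg A I\<^esub> (I +> y)"
    if "x \<in> carrier A" "y \<in> carrier A" for x y
    using that by (simp add: a_minus_def)
  have "{X \<otimes>\<^bsub>quot_alg A I\<^esub> Y \<ominus>\<^bsub>quot_alg A I\<^esub> Y \<otimes>\<^bsub>quot_alg A I\<^esub> X | X Y.
          X \<in> carrier (quot_alg A I) \<and> Y \<in> carrier (quot_alg A I)}
      = (+>) I ` {x \<otimes> y \<ominus> y \<otimes> x | x y. x \<in> carrier A \<and> y \<in> carrier A}" (is "?L = _ ` ?K")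
  proof (intro equalityI subsetI)
    fix Z assume "Z \<in> ?L"
    then obtain x y where "x \<in> carrier A" "y \<in> carrier A" "Z = I +> (x \<otimes> y \<ominus> y \<otimes> x)"
      by (auto simp: quot_alg_simps(1,2) coset_mult minus rng_m_closed)
    then show "Z \<in> (+>) I ` ?K"
      by blast
  next
    fix Z assume "Z \<in> (+>) I ` ?K"
    then obtain x y where xy: "x \<in> carrier A" "y \<in> carrier A" and "Z = I +> (x \<otimes> y \<ominus> y \<otimes> x)"
      by blast
    then have "Z = (I +> x) \<otimes>\<^bsub>quot_alg A I\<^esub> (I +> y) \<ominus>\<^bsub>quot_alg A I\<^esub> (I +> y) \<otimes>\<^bsub>quot_alg A I\<^esub> (I +> x)"
      by (simp add: quot_alg_simps(2) coset_mult minus rng_m_closed)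
    then show "Z \<in> ?L"
      using xy q.hom_closed by blast
  qed
  then show ?thesis
    unfolding commutators_def
    using group_hom.generate_img[OF q.a_group_hom, of ?K] commutator_set_subset by simp
qed

text \<open>Since c(h + x) = ch + cx with ch in I, all cosets in the union defining the scalar
  multiple agree. The assumptions concern one fixed \<open>c\<close>, with no reference to a ring of
  scalars.\<close>

lemma coset_smult:
  assumes c: "\<And>x. x \<in> carrier A \<Longrightarrow> c \<odot> x \<in> carrier A"
    and add: "\<And>x y. \<lbrakk>x \<in> carrier A; y \<in> carrier A\<rbrakk> \<Longrightarrow> c \<odot> (x \<oplus> y) = c \<odot> x \<oplus> c \<odot> y"
    and I: "\<And>x. x \<in> I \<Longrightarrow> c \<odot> x \<in> I" and x: "x \<in> carrier A"
  shows "c \<odot>\<^bsub>quot_alg A I\<^esub> (I +> x) = I +> (c \<odot> x)"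
proof -
  have "I +> (c \<odot> y) = I +> (c \<odot> x)" if "y \<in> I +> x" for y
    using that x by (auto simp: mem_coset_iff add coset_shift I c)
  then show ?thesis
    using a_rcos_self[OF x] unfolding quot_alg_simps by blast
qed

lemma rng_algebra_quot_alg:
  assumes "rng_algebra C A" and I: "\<And>c x. \<lbrakk>c \<in> carrier C; x \<in> I\<rbrakk> \<Longrightarrow> c \<odot> x \<in> I"
  shows "rng_algebra C (quot_alg A I)"
proof -
  interpret alg: rng_algebra C A
    by fact
  have smult: "c \<odot>\<^bsub>quot_alg A I\<^esub> (I +> x) = I +> (c \<odot> x)"
    if "c \<in> carrier C" "x \<in> carrier A" for c x
    using that by (intro coset_smult) (auto simp: I alg.alg_smult_closed alg.alg_smult_r_distr)
  show ?thesis
    by (intro rng_algebra.intro rng_algebra_axioms.intro alg.C.comm_rng_axioms rng_quot_alg)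
       (auto simp: quot_alg_simps(1-4) smult coset_mult a_rcos_sum rng_m_closed alg.C.rng_m_closed
         alg.alg_smult_closed alg.alg_smult_l_distr alg.alg_smult_r_distr alg.alg_smult_assoc
         alg.alg_smult_mult_l alg.alg_smult_mult_r)
qed

section \<open>Traces that vanish on the ideal\<close>

context
  fixes T :: "('r, 'l) ring_scheme" and t
  assumes trace: "ring_trace A T t" and vanish: "\<And>x. x \<in> I \<Longrightarrow> t x = \<zero>\<^bsub>T\<^esub>"
begin

interpretation tr: ring_trace A T t
  by (rule trace)

interpretation tr: abelian_group_hom A T t
  by (intro abelian_group_homI' abelian_group_axioms tr.T.abelian_group_axioms tr.trace_closed
      tr.trace_add)

lemma trace_mem_coset:
  assumes "x \<in> carrier A" and "y \<in> I +> x"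
  shows "t y = t x"
  using assms by (auto simp: mem_coset_iff vanish)

lemma induced_coset:
  assumes x: "x \<in> carrier A"
  shows "induced t (I +> x) = t x"
proof -
  have "t ` (I +> x) = {t x}"
    using a_rcos_self[OF x] trace_mem_coset[OF x] by blast
  then show ?thesis
    by (simp add: induced_def)
qed

lemma ring_trace_induced: "ring_trace (quot_alg A I) T (induced t)"
  by (intro ring_trace.intro ring_trace_axioms.intro rng_quot_alg tr.T.rng_axioms)
     (auto simp: quot_alg_simps a_rcos_sum coset_mult induced_coset rng_m_closed tr.trace_mult)

text \<open>A multiplication by a scalar that does not preserve \<open>I\<close> maps a coset to a union of several
  cosets, but the trace is still constant on that union.\<close>

lemma induced_smult:
  assumes c: "\<And>x. x \<in> carrier A \<Longrightarrow> c \<odot> x \<in> carrier A"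
    and t: "\<And>x. x \<in> carrier A \<Longrightarrow> t (c \<odot> x) = d (t x)"
    and x: "x \<in> carrier A"
  shows "induced t (c \<odot>\<^bsub>quot_alg A I\<^esub> (I +> x)) = d (induced t (I +> x))"
proof -
  \<comment> \<open>The chain is t(z) = t(cy) = d(t(y)) = d(t(x)). Here \<open>d\<close> stands for
    the action of \<open>c\<close> on the values, because \<open>T\<close> is only a ring in this
    context.\<close>
  have "t z = d (t x)" if "y \<in> I +> x" "z \<in> I +> (c \<odot> y)" for y z
    using that x a_elemrcos_carrier[OF x that(1)]
    by (metis c t trace_mem_coset)
  then have "t ` (c \<odot>\<^bsub>quot_alg A I\<^esub> (I +> x)) \<subseteq> {d (t x)}"
    unfolding quot_alg_simps by auto
  \<comment> \<open>The union must be nonempty for its image to be a singleton, on which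
    \<open>the_elem\<close> is determined.\<close>
  moreover have "c \<odot> x \<in> c \<odot>\<^bsub>quot_alg A I\<^esub> (I +> x)"
    using a_rcos_self[OF x] a_rcos_self[OF c[OF x]] unfolding quot_alg_simps by blast
  ultimately have "t ` (c \<odot>\<^bsub>quot_alg A I\<^esub> (I +> x)) = {d (t x)}"
    using t[OF x] by (metis image_eqI subset_singletonD empty_iff)
  then show ?thesis
    using induced_coset[OF x] by (simp add: induced_def)
qed

lemma minimal_iff_minimal_induced:
  "minimal A T t \<longleftrightarrow> minimal (quot_alg A I) T (induced t) \<and> I \<subseteq> commutators A"
proof (intro iffI conjI)
  assume "minimal A T t"
  then show "minimal (quot_alg A I) T (induced t)"
    by (auto simp: minimal_def commutators_quot_alg quot_alg_simps induced_coset)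
  show "I \<subseteq> commutators A"
    using \<open>minimal A T t\<close> vanish a_subset by (auto simp: minimal_def)
next
  assume *: "minimal (quot_alg A I) T (induced t) \<and> I \<subseteq> commutators A"
  interpret K: additive_subgroup "commutators A" A
    by (intro additive_subgroup.intro subgroup_commutators)
  show "minimal A T t"
    unfolding minimal_def
  proof (intro ballI impI)
    fix x assume x: "x \<in> carrier A" and "t x = \<zero>\<^bsub>T\<^esub>"
    then have "I +> x \<in> (+>) I ` commutators A"
      using * by (auto simp: minimal_def commutators_quot_alg quot_alg_simps induced_coset)
    then obtain s where "s \<in> commutators A" and "I +> x = I +> s"
      by blast
    \<comment> \<open>\<open>x\<close> lies in its own coset, which is also the coset of
      \<open>s\<close>; hence \<open>x\<close> and \<open>s\<close> differ by an element of
      I.\<close>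
    then obtain h where "h \<in> I" and "x = h \<oplus> s"
      using a_rcos_self[OF x] mem_coset_iff by auto
    then show "x \<in> commutators A"
      using * \<open>s \<in> commutators A\<close> by auto
  qed
qed

end

end

section \<open>The contracted semigroup ring\<close>

locale contracted_semigroup_ring = C: comm_rng C + G: semigroup_with_zero G
  for C :: "('c, 'k) ring_scheme" and G :: "('g, 'n) zsemigroup_scheme"
begin

lemma carrier_contracted_ring:
  "a \<in> carrier (contracted_ring C G) \<longleftrightarrow>
    (\<forall>g. a g \<in> carrier C) \<and> finite (supp C a) \<and> supp C a \<subseteq> carrier G - {szero G}"
  by (auto simp: contracted_ring_def)

lemma contracted_ring_simps:
  "add (contracted_ring C G) = (\<lambda>a b x. a x \<oplus>\<^bsub>C\<^esub> b x)"
  "smult (contracted_ring C G) = (\<lambda>c a x. c \<otimes>\<^bsub>C\<^esub> a x)"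
  by (simp_all add: contracted_ring_def)

lemma coeff_eq_zero: "g \<notin> supp C a \<Longrightarrow> a g = \<zero>\<^bsub>C\<^esub>"
  by (simp add: supp_def)

text \<open>Supports can shrink under scaling when C has zero divisors. Letting the sum run over any
  finite superset of the product of the supports allows different products to be compared over one
  index set.\<close>

lemma contracted_mult:
  assumes a: "a \<in> carrier (contracted_ring C G)" and b: "b \<in> carrier (contracted_ring C G)"
    and S: "finite S" "supp C a \<times> supp C b \<subseteq> S" and x: "x \<noteq> szero G"
  shows "(a \<otimes>\<^bsub>contracted_ring C G\<^esub> b) x =
    (\<Oplus>\<^bsub>C\<^esub>p\<in>{p \<in> S. fst p \<cdot>\<^bsub>G\<^esub> snd p = x}. a (fst p) \<otimes>\<^bsub>C\<^esub> b (snd p))"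
proof -
  have "(a \<otimes>\<^bsub>contracted_ring C G\<^esub> b) x = (\<Oplus>\<^bsub>C\<^esub>p\<in>{(g, h). g \<in> supp C a \<and> h \<in> supp C b
      \<and> g \<cdot>\<^bsub>G\<^esub> h = x}. case p of (g, h) \<Rightarrow> a g \<otimes>\<^bsub>C\<^esub> b h)"
    using x by (simp add: contracted_ring_def)
  also have "\<dots> = (\<Oplus>\<^bsub>C\<^esub>p\<in>{p \<in> S. fst p \<cdot>\<^bsub>G\<^esub> snd p = x}. a (fst p) \<otimes>\<^bsub>C\<^esub> b (snd p))"
  proof (rule C.add.finprod_mono_neutral_cong_left)
    show "a (fst p) \<otimes>\<^bsub>C\<^esub> b (snd p) = \<zero>\<^bsub>C\<^esub>"
      if "p \<in> {p \<in> S. fst p \<cdot>\<^bsub>G\<^esub> snd p = x} - {(g, h). g \<in> supp C a \<and> h \<in> supp C b \<and> g \<cdot>\<^bsub>G\<^esub> h = x}"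
      for p
      using that a b coeff_eq_zero[of "fst p" a] coeff_eq_zero[of "snd p" b]
      by (cases "fst p \<in> supp C a") (auto simp: carrier_contracted_ring case_prod_beta)
  qed (use S a b in \<open>auto simp: carrier_contracted_ring C.rng_m_closed\<close>)
  finally show ?thesis .
qed

lemma supp_smult_subset: "c \<in> carrier C \<Longrightarrow> supp C (\<lambda>x. c \<otimes>\<^bsub>C\<^esub> a x) \<subseteq> supp C a"
  by (auto simp: supp_def)

lemma contracted_smult_closed:
  "\<lbrakk>c \<in> carrier C; a \<in> carrier (contracted_ring C G)\<rbrakk>
    \<Longrightarrow> c \<odot>\<^bsub>contracted_ring C G\<^esub> a \<in> carrier (contracted_ring C G)"
  using supp_smult_subset[of c a]
  by (auto simp: carrier_contracted_ring contracted_ring_simps C.rng_m_closed dest: finite_subset)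

lemma contracted_smult_mult:
  assumes c: "c \<in> carrier C" and a: "a \<in> carrier (contracted_ring C G)"
    and b: "b \<in> carrier (contracted_ring C G)"
  shows "(c \<odot>\<^bsub>contracted_ring C G\<^esub> a) \<otimes>\<^bsub>contracted_ring C G\<^esub> b
      = c \<odot>\<^bsub>contracted_ring C G\<^esub> (a \<otimes>\<^bsub>contracted_ring C G\<^esub> b)" (is ?left)
    and "a \<otimes>\<^bsub>contracted_ring C G\<^esub> (c \<odot>\<^bsub>contracted_ring C G\<^esub> b)
      = c \<odot>\<^bsub>contracted_ring C G\<^esub> (a \<otimes>\<^bsub>contracted_ring C G\<^esub> b)" (is ?right)
proof -
  let ?CG = "contracted_ring C G"
  let ?S = "supp C a \<times> supp C b"
  have coeff: "a g \<in> carrier C" "b g \<in> carrier C" for g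
    using a b by (auto simp: carrier_contracted_ring)
  have fin: "finite ?S"
    using a b by (simp add: carrier_contracted_ring)
  have zero: "(d \<otimes>\<^bsub>?CG\<^esub> e) (szero G) = \<zero>\<^bsub>C\<^esub>" for d e
    by (simp add: contracted_ring_def)
  have scaled: "(c \<odot>\<^bsub>?CG\<^esub> (a \<otimes>\<^bsub>?CG\<^esub> b)) x =
      (\<Oplus>\<^bsub>C\<^esub>p\<in>{p \<in> ?S. fst p \<cdot>\<^bsub>G\<^esub> snd p = x}. c \<otimes>\<^bsub>C\<^esub> (a (fst p) \<otimes>\<^bsub>C\<^esub> b (snd p)))"
    if "x \<noteq> szero G" for x
    unfolding contracted_ring_simps contracted_mult[OF a b fin subset_refl that]
    by (intro abelian_group_hom.hom_finsum[OF C.hom_l_mult[OF c]])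
       (auto simp: coeff C.rng_m_closed)
  show ?left
  proof
    fix x
    show "((c \<odot>\<^bsub>?CG\<^esub> a) \<otimes>\<^bsub>?CG\<^esub> b) x = (c \<odot>\<^bsub>?CG\<^esub> (a \<otimes>\<^bsub>?CG\<^esub> b)) x"
    proof (cases "x = szero G")
      case True
      with c show ?thesis
        by (simp add: zero contracted_ring_simps)
    next
      case False
      have "supp C (c \<odot>\<^bsub>?CG\<^esub> a) \<times> supp C b \<subseteq> ?S"
        using supp_smult_subset[OF c, of a] by (auto simp: contracted_ring_simps)
      then show ?thesis
        unfolding scaled[OF False] using c False
        by (subst contracted_mult[OF contracted_smult_closed[OF c a] b fin])
           (auto simp: contracted_ring_simps coeff C.rng_m_closed C.rng_m_assoc
             intro!: C.finsum_cong')
    qed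
  qed
  show ?right
  proof
    fix x
    show "(a \<otimes>\<^bsub>?CG\<^esub> (c \<odot>\<^bsub>?CG\<^esub> b)) x = (c \<odot>\<^bsub>?CG\<^esub> (a \<otimes>\<^bsub>?CG\<^esub> b)) x"
    proof (cases "x = szero G")
      case True
      with c show ?thesis
        by (simp add: zero contracted_ring_simps)
    next
      case False
      have "supp C a \<times> supp C (c \<odot>\<^bsub>?CG\<^esub> b) \<subseteq> ?S"
        using supp_smult_subset[OF c, of b] by (auto simp: contracted_ring_simps)
      \<comment> \<open>Moving the scalar past the left coefficient is where commutativity of C
        enters.\<close>
      moreover have "a g \<otimes>\<^bsub>C\<^esub> (c \<otimes>\<^bsub>C\<^esub> b h) = c \<otimes>\<^bsub>C\<^esub> (a g \<otimes>\<^bsub>C\<^esub> b h)" for g h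
        using c coeff by (metis C.rng_m_assoc C.rng_m_comm)
      ultimately show ?thesis
        unfolding scaled[OF False] using c False
        by (subst contracted_mult[OF a contracted_smult_closed[OF c b] fin])
           (auto simp: contracted_ring_simps coeff C.rng_m_closed intro!: C.finsum_cong')
    qed
  qed
qed

lemma rng_algebra_contracted_ring:
  assumes "rng (contracted_ring C G)"
  shows "rng_algebra C (contracted_ring C G)"
proof -
  have coeff: "a g \<in> carrier C" if "a \<in> carrier (contracted_ring C G)" for a g
    using that by (simp add: carrier_contracted_ring)
  show ?thesis
    by (intro rng_algebra.intro rng_algebra_axioms.intro C.comm_rng_axioms assms
        contracted_smult_closed contracted_smult_mult)
       (auto simp: contracted_ring_simps coeff C.rng_l_distr C.rng_r_distr C.rng_m_assoc)
qed

end

section \<open>The trace defined by a central map\<close>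

locale central_map = contracted_semigroup_ring C G + R: rng_algebra C R
  for C :: "('c, 'k) ring_scheme" and G :: "('g, 'n) zsemigroup_scheme"
    and R :: "('c, 'r, 'm) module_scheme" +
  fixes \<delta> :: "'g \<Rightarrow> 'r"
  assumes map_closed: "g \<in> carrier G \<Longrightarrow> \<delta> g \<in> carrier R"
    and map_zero: "\<delta> (szero G) = \<zero>\<^bsub>R\<^esub>"
    and map_central: "\<lbrakk>g \<in> carrier G; h \<in> carrier G\<rbrakk> \<Longrightarrow> \<delta> (g \<cdot>\<^bsub>G\<^esub> h) = \<delta> (h \<cdot>\<^bsub>G\<^esub> g)"
begin

text \<open>Cancellation can make the support of a sum or product smaller than expected; with this
  freedom in the index set such supports need never be computed. \<open>S\<close> may even contain
  the zero of G.\<close>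

lemma t_map_superset:
  assumes "\<And>g. a g \<in> carrier C" and "supp C a \<subseteq> S" and "finite S" and "S \<subseteq> carrier G"
  shows "t_map C R \<delta> a = (\<Oplus>\<^bsub>R\<^esub>g\<in>S. a g \<odot>\<^bsub>R\<^esub> \<delta> g)"
  unfolding t_map_def
  by (rule R.A.add.finprod_mono_neutral_cong_left)
     (use assms in \<open>auto simp: map_closed R.alg_smult_closed coeff_eq_zero subset_iff\<close>)

lemma t_map_closed: "a \<in> carrier (contracted_ring C G) \<Longrightarrow> t_map C R \<delta> a \<in> carrier R"
  unfolding t_map_def
  by (intro R.A.finsum_closed) (auto simp: carrier_contracted_ring map_closed R.alg_smult_closed)

lemma t_map_add:
  assumes a: "a \<in> carrier (contracted_ring C G)" and b: "b \<in> carrier (contracted_ring C G)"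
  shows "t_map C R \<delta> (a \<oplus>\<^bsub>contracted_ring C G\<^esub> b) = t_map C R \<delta> a \<oplus>\<^bsub>R\<^esub> t_map C R \<delta> b"
proof -
  let ?S = "supp C a \<union> supp C b"
  have coeff: "a g \<in> carrier C" "b g \<in> carrier C" for g
    using a b by (auto simp: carrier_contracted_ring)
  have S: "finite ?S" "?S \<subseteq> carrier G"
    using a b by (auto simp: carrier_contracted_ring)
  then have closed: "\<delta> g \<in> carrier R" if "g \<in> ?S" for g
    using that map_closed by blast
  have "supp C (\<lambda>x. a x \<oplus>\<^bsub>C\<^esub> b x) \<subseteq> ?S"
    by (auto simp: supp_def)
  then have "t_map C R \<delta> (a \<oplus>\<^bsub>contracted_ring C G\<^esub> b)
      = (\<Oplus>\<^bsub>R\<^esub>g\<in>?S. (a g \<oplus>\<^bsub>C\<^esub> b g) \<odot>\<^bsub>R\<^esub> \<delta> g)"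
    unfolding contracted_ring_simps by (intro t_map_superset) (use S coeff in auto)
  also have "\<dots> = (\<Oplus>\<^bsub>R\<^esub>g\<in>?S. a g \<odot>\<^bsub>R\<^esub> \<delta> g \<oplus>\<^bsub>R\<^esub> b g \<odot>\<^bsub>R\<^esub> \<delta> g)"
    by (intro R.A.finsum_cong') (auto simp: coeff closed R.alg_smult_l_distr R.alg_smult_closed)
  also have "\<dots> = (\<Oplus>\<^bsub>R\<^esub>g\<in>?S. a g \<odot>\<^bsub>R\<^esub> \<delta> g) \<oplus>\<^bsub>R\<^esub> (\<Oplus>\<^bsub>R\<^esub>g\<in>?S. b g \<odot>\<^bsub>R\<^esub> \<delta> g)"
    by (intro R.A.finsum_addf) (auto simp: coeff closed R.alg_smult_closed)
  also have "\<dots> = t_map C R \<delta> a \<oplus>\<^bsub>R\<^esub> t_map C R \<delta> b"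
    using S coeff by (simp add: t_map_superset[of _ ?S])
  finally show ?thesis .
qed

lemma t_map_smult:
  assumes c: "c \<in> carrier C" and a: "a \<in> carrier (contracted_ring C G)"
  shows "t_map C R \<delta> (c \<odot>\<^bsub>contracted_ring C G\<^esub> a) = c \<odot>\<^bsub>R\<^esub> t_map C R \<delta> a"
proof -
  have coeff: "a g \<in> carrier C" for g
    using a by (auto simp: carrier_contracted_ring)
  have S: "finite (supp C a)" "supp C a \<subseteq> carrier G"
    using a by (auto simp: carrier_contracted_ring)
  then have closed: "\<delta> g \<in> carrier R" if "g \<in> supp C a" for g
    using that map_closed by blast
  have "t_map C R \<delta> (c \<odot>\<^bsub>contracted_ring C G\<^esub> a)
      = (\<Oplus>\<^bsub>R\<^esub>g\<in>supp C a. (c \<otimes>\<^bsub>C\<^esub> a g) \<odot>\<^bsub>R\<^esub> \<delta> g)"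
    unfolding contracted_ring_simps
    by (intro t_map_superset supp_smult_subset) (use S c coeff in \<open>auto simp: C.rng_m_closed\<close>)
  also have "\<dots> = (\<Oplus>\<^bsub>R\<^esub>g\<in>supp C a. c \<odot>\<^bsub>R\<^esub> (a g \<odot>\<^bsub>R\<^esub> \<delta> g))"
    by (intro R.A.finsum_cong') (auto simp: c coeff closed R.alg_smult_assoc R.alg_smult_closed)
  also have "\<dots> = c \<odot>\<^bsub>R\<^esub> t_map C R \<delta> a"
    unfolding t_map_def
    by (intro abelian_group_hom.hom_finsum[OF R.hom_smult[OF c], symmetric])
       (auto simp: coeff closed R.alg_smult_closed)
  finally show ?thesis .
qed

text \<open>Pairs with product \<open>0\<close> are absent from the convolution but may be included here, because
  \<open>\<delta>\<close> preserves zero.\<close>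

lemma t_map_mult:
  assumes a: "a \<in> carrier (contracted_ring C G)" and b: "b \<in> carrier (contracted_ring C G)"
  shows "t_map C R \<delta> (a \<otimes>\<^bsub>contracted_ring C G\<^esub> b) =
    (\<Oplus>\<^bsub>R\<^esub>p\<in>supp C a \<times> supp C b. (a (fst p) \<otimes>\<^bsub>C\<^esub> b (snd p)) \<odot>\<^bsub>R\<^esub> \<delta> (fst p \<cdot>\<^bsub>G\<^esub> snd p))"
proof -
  let ?S = "supp C a \<times> supp C b"
  let ?m = "\<lambda>p. fst p \<cdot>\<^bsub>G\<^esub> snd p"
  let ?ab = "a \<otimes>\<^bsub>contracted_ring C G\<^esub> b"
  let ?fib = "\<lambda>x. {p \<in> ?S. ?m p = x}"
  let ?coef = "\<lambda>p. a (fst p) \<otimes>\<^bsub>C\<^esub> b (snd p)"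
  have fin: "finite ?S"
    using a b by (simp add: carrier_contracted_ring)
  have coeff: "?coef p \<in> carrier C" for p
    using a b by (auto simp: carrier_contracted_ring C.rng_m_closed)
  have mG: "?m p \<in> carrier G" if "p \<in> ?S" for p
    using that a b by (auto simp: carrier_contracted_ring intro!: G.smul_closed)
  have ab: "?ab x = (\<Oplus>\<^bsub>C\<^esub>p\<in>?fib x. ?coef p)" if "x \<noteq> szero G" for x
    by (rule contracted_mult[OF a b fin subset_refl that])
  have ab0: "?ab (szero G) = \<zero>\<^bsub>C\<^esub>"
    by (simp add: contracted_ring_def)
  have ab_closed: "?ab x \<in> carrier C" for x
    by (cases "x = szero G") (auto simp: ab ab0 coeff)
  have fib_empty: "?ab x = \<zero>\<^bsub>C\<^esub>" if "x \<notin> ?m ` ?S" for x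
  proof (cases "x = szero G")
    case False
    have "?fib x = {}"
      using that by blast
    then show ?thesis
      by (simp only: ab[OF False] C.finsum_empty)
  qed (simp add: ab0)
  then have "supp C ?ab \<subseteq> ?m ` ?S"
    by (auto simp: supp_def)
  then have "t_map C R \<delta> ?ab = (\<Oplus>\<^bsub>R\<^esub>x\<in>?m ` ?S. ?ab x \<odot>\<^bsub>R\<^esub> \<delta> x)"
    using fin mG by (intro t_map_superset ab_closed) blast+
  also have "\<dots> = (\<Oplus>\<^bsub>R\<^esub>x\<in>?m ` ?S. \<Oplus>\<^bsub>R\<^esub>p\<in>?fib x. ?coef p \<odot>\<^bsub>R\<^esub> \<delta> (?m p))"
  proof (intro R.A.finsum_cong' refl funcsetI)
    fix x assume "x \<in> ?m ` ?S"
    then have x: "\<delta> x \<in> carrier R"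
      using mG map_closed by blast
    show "(\<Oplus>\<^bsub>R\<^esub>p\<in>?fib x. ?coef p \<odot>\<^bsub>R\<^esub> \<delta> (?m p)) \<in> carrier R"
      using x by (intro R.A.finsum_closed) (auto simp: coeff R.alg_smult_closed)
    show "?ab x \<odot>\<^bsub>R\<^esub> \<delta> x = (\<Oplus>\<^bsub>R\<^esub>p\<in>?fib x. ?coef p \<odot>\<^bsub>R\<^esub> \<delta> (?m p))"
    proof (cases "x = szero G")
      case True
      \<comment> \<open>Over the zero of G both sides vanish, for different reasons: on the left the
        coefficient is zero by definition, on the right every term contains \<delta>(0) = 0.\<close>
      have "(\<Oplus>\<^bsub>R\<^esub>p\<in>?fib x. ?coef p \<odot>\<^bsub>R\<^esub> \<delta> (?m p)) = \<zero>\<^bsub>R\<^esub>"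
        by (intro R.A.add.finprod_one_eqI) (auto simp: True map_zero coeff)
      then show ?thesis
        by (simp add: True ab0 map_zero)
    next
      case False
      have "?ab x \<odot>\<^bsub>R\<^esub> \<delta> x = (\<Oplus>\<^bsub>R\<^esub>p\<in>?fib x. ?coef p \<odot>\<^bsub>R\<^esub> \<delta> x)"
        unfolding ab[OF False]
        by (intro abelian_group_hom.hom_finsum[OF R.hom_scalar[OF x]]) (auto simp: coeff)
      also have "\<dots> = (\<Oplus>\<^bsub>R\<^esub>p\<in>?fib x. ?coef p \<odot>\<^bsub>R\<^esub> \<delta> (?m p))"
        using x by (intro R.A.finsum_cong') (auto simp: coeff R.alg_smult_closed)
      finally show ?thesis .
    qed
  qed
  \<comment> \<open>The fibres of the multiplication partition the set of pairs, so the iterated sum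
    becomes a single one.\<close>
  also have "\<dots> = (\<Oplus>\<^bsub>R\<^esub>p\<in>(\<Union>x\<in>?m ` ?S. ?fib x). ?coef p \<odot>\<^bsub>R\<^esub> \<delta> (?m p))"
    using fin mG
    by (intro R.A.add.finprod_UN_disjoint[symmetric])
       (auto simp: pairwise_def disjnt_def coeff map_closed R.alg_smult_closed)
  also have "(\<Union>x\<in>?m ` ?S. ?fib x) = ?S"
    by auto
  finally show ?thesis .
qed

text \<open>Reindexing the formula of \<open>t_map_mult\<close> by the swap of pairs turns the sum
  for ba into the sum for ab: commutativity of C handles the coefficients, centrality of \<delta>
  the values.\<close>

lemma t_map_mult_commute:
  assumes a: "a \<in> carrier (contracted_ring C G)" and b: "b \<in> carrier (contracted_ring C G)"
  shows "t_map C R \<delta> (a \<otimes>\<^bsub>contracted_ring C G\<^esub> b) = t_map C R \<delta> (b \<otimes>\<^bsub>contracted_ring C G\<^esub> a)"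
proof -
  let ?S = "supp C a \<times> supp C b"
  let ?f = "\<lambda>p. (b (fst p) \<otimes>\<^bsub>C\<^esub> a (snd p)) \<odot>\<^bsub>R\<^esub> \<delta> (fst p \<cdot>\<^bsub>G\<^esub> snd p)"
  have coeff: "a g \<in> carrier C" "b g \<in> carrier C" for g
    using a b by (auto simp: carrier_contracted_ring)
  have S: "supp C a \<subseteq> carrier G" "supp C b \<subseteq> carrier G"
    using a b by (auto simp: carrier_contracted_ring)
  then have closed: "?f \<in> supp C b \<times> supp C a \<rightarrow> carrier R"
    by (auto simp: coeff subset_iff
        intro!: R.alg_smult_closed C.rng_m_closed map_closed G.smul_closed)
  have swap: "prod.swap ` ?S = supp C b \<times> supp C a"
    by (rule product_swap)
  have "t_map C R \<delta> (b \<otimes>\<^bsub>contracted_ring C G\<^esub> a) = finsum R ?f (prod.swap ` ?S)"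
    unfolding swap by (rule t_map_mult[OF b a])
  also have "\<dots> = (\<Oplus>\<^bsub>R\<^esub>p\<in>?S. ?f (prod.swap p))"
    using closed by (intro R.A.finsum_reindex) (auto simp: swap)
  also have "\<dots> = (\<Oplus>\<^bsub>R\<^esub>p\<in>?S. (a (fst p) \<otimes>\<^bsub>C\<^esub> b (snd p)) \<odot>\<^bsub>R\<^esub> \<delta> (fst p \<cdot>\<^bsub>G\<^esub> snd p))"
    using S
    by (intro R.A.finsum_cong')
       (auto simp: coeff C.rng_m_comm subset_iff map_central
         intro!: R.alg_smult_closed C.rng_m_closed map_closed G.smul_closed)
  also have "\<dots> = t_map C R \<delta> (a \<otimes>\<^bsub>contracted_ring C G\<^esub> b)"
    by (rule t_map_mult[OF a b, symmetric])
  finally show ?thesis ..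
qed

lemma ring_trace_t_map:
  assumes "rng (contracted_ring C G)"
  shows "ring_trace (contracted_ring C G) R (t_map C R \<delta>)"
  by (intro ring_trace.intro ring_trace_axioms.intro assms R.A.rng_axioms)
     (auto simp: t_map_closed t_map_add intro: t_map_mult_commute)

end

theorem proposition16:
  fixes C :: "('c, 'k) ring_scheme"
    and R :: "('c, 'r, 'm) module_scheme"
    and G :: "('g, 'n) zsemigroup_scheme"
    and \<delta> :: "'g \<Rightarrow> 'r"
    and I :: "('g \<Rightarrow> 'c) set"
  defines "CG \<equiv> contracted_ring C G"
    and "t \<equiv> t_map C R \<delta>"
  assumes "comm_rng C"
    and "rng_algebra C R"
    and "semigroup_with_zero G"
    and "\<delta> \<in> carrier G \<rightarrow> carrier R"
    and "\<delta> (szero G) = \<zero>\<^bsub>R\<^esub>"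
    and "\<forall>g\<in>carrier G. \<forall>h\<in>carrier G. \<delta> (g \<cdot>\<^bsub>G\<^esub> h) = \<delta> (h \<cdot>\<^bsub>G\<^esub> g)"
    and "rng_ideal I CG"
    and "\<forall>x\<in>I. t x = \<zero>\<^bsub>R\<^esub>"
  shows "(\<forall>r\<in>carrier CG. induced t (I +>\<^bsub>CG\<^esub> r) = t r)
    \<and> linear_trace C (quot_alg CG I) R (induced t)
    \<and> ((\<forall>c\<in>carrier C. \<forall>x\<in>I. c \<odot>\<^bsub>CG\<^esub> x \<in> I) \<longrightarrow> rng_algebra C (quot_alg CG I))
    \<and> (minimal CG R t \<longleftrightarrow>
        minimal (quot_alg CG I) R (induced t) \<and> I \<subseteq> commutators CG)"
proof -
  interpret central_map C G R \<delta>
    using assms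
    by (intro central_map.intro central_map_axioms.intro contracted_semigroup_ring.intro) auto
  interpret CG: rng_ideal_of_module I CG
    using assms by (simp add: rng_ideal_of_module_def)
  have trace: "ring_trace CG R t"
    unfolding CG_def t_def using CG.rng_axioms by (intro ring_trace_t_map) (simp add: CG_def)
  have vanish: "t x = \<zero>\<^bsub>R\<^esub>" if "x \<in> I" for x
    using assms that by blast
  have alg: "rng_algebra C CG"
    unfolding CG_def using CG.rng_axioms
    by (intro rng_algebra_contracted_ring) (simp add: CG_def)
  have smult: "induced t (c \<odot>\<^bsub>quot_alg CG I\<^esub> X) = c \<odot>\<^bsub>R\<^esub> induced t X"
    if "c \<in> carrier C" and X: "X \<in> carrier (quot_alg CG I)" for c X
  proof -
    obtain x where "x \<in> carrier CG" and "X = I +>\<^bsub>CG\<^esub> x"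
      using X by (auto simp: CG.quot_alg_simps)
    with \<open>c \<in> carrier C\<close> show ?thesis
      \<comment> \<open>The action of \<open>c\<close> on R is supplied as \<open>d\<close>, so only
        linearity of \<open>t\<close> is used and \<open>c\<close> need not map I into
        itself.\<close>
      using CG.induced_smult[OF trace vanish, of c "\<lambda>y. c \<odot>\<^bsub>R\<^esub> y" x]
      by (simp add: CG_def t_def contracted_smult_closed t_map_smult)
  qed
  have "linear_trace C (quot_alg CG I) R (induced t)"
    by (intro linear_trace.intro linear_trace_axioms.intro
        CG.ring_trace_induced[OF trace vanish] smult)
  moreover have "rng_algebra C (quot_alg CG I)"
    if "\<forall>c\<in>carrier C. \<forall>x\<in>I. c \<odot>\<^bsub>CG\<^esub> x \<in> I"
    using that by (intro CG.rng_algebra_quot_alg[OF alg]) blast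
  ultimately show ?thesis
    using CG.induced_coset[OF trace vanish] CG.minimal_iff_minimal_induced[OF trace vanish]
    by blast
qed

end
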